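(* Let $H_1$ and $H_2$ be two graphs such that $|V(H_1)|=|V(H_2)|=n$. Then $G=H_1\bigtriangledown H_2$ is an $L$-exact graph.
   Context: All graphs are finite, simple and unweighted. The join $H_1\bigtriangledown H_2$ of two graphs on disjoint vertex sets is obtained from their disjoint union by adding all edges $uv$ with $u\in V(H_1)$, $v\in V(H_2)$. For a graph $G$ on $N$ vertices, $A(G)$ is the adjacency matrix, $D(G)$ the diagonal degree matrix, $L(G)=D(G)-A(G)$, and $\mu_1(G)$ is the largest eigenvalue of $L(G)$; $mcut(G)$ is the maximum over $X\subseteq V(G)$ of the number of edges with exactly one endpoint in $X$. $G$ is $L$-exact if $\mu_1(G)=\frac{4}{N}mcut(G)$. *)

theory Defs
  imports "Graph_Theory.Pair_Digraph" "Jordan_Normal_Form.Char_Poly"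
begin

text \<open>
  Finite simple graphs are the structures satisfying the library locale predicate
  \<open>pair_graph\<close>: finite, loop-free and symmetric sets of arcs. An undirected edge
  $uv$ is represented by the two arcs $(u,v)$ and $(v,u)$, so the degree of a vertex is its
  \<open>out_degree\<close>.
\<close>

definition graph_join :: "'a pair_pre_digraph \<Rightarrow> 'a pair_pre_digraph \<Rightarrow> 'a pair_pre_digraph"
    (infixl "\<nabla>" 65) where
  "H1 \<nabla> H2 = \<lparr> pverts = pverts H1 \<union> pverts H2,
     parcs = parcs H1 \<union> parcs H2 \<union> pverts H1 \<times> pverts H2 \<union> pverts H2 \<times> pverts H1 \<rparr>"

lemma pair_graph_join:
  assumes "pair_graph H1" "pair_graph H2" "pverts H1 \<inter> pverts H2 = {}"
  shows "pair_graph (H1 \<nabla> H2)"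
proof -
  interpret H1: pair_graph H1 by fact
  interpret H2: pair_graph H2 by fact
  show ?thesis
  proof
    show "symmetric (with_proj (H1 \<nabla> H2))"
      using H1.pair_sym_arcs H2.pair_sym_arcs
      unfolding symmetric_def sym_def by (auto simp: graph_join_def)
  qed (use assms(3) in \<open>auto simp: graph_join_def H1.wellformed' H2.wellformed'
      dest: H1.pair_no_loops H2.pair_no_loops\<close>)
qed

definition edges :: "'a pair_pre_digraph \<Rightarrow> 'a set set" where
  "edges G = {{u, v} | u v. (u, v) \<in> parcs G}"

definition cut_edges :: "'a pair_pre_digraph \<Rightarrow> 'a set \<Rightarrow> 'a set set" where
  "cut_edges G X = {e \<in> edges G. card (e \<inter> X) = 1}"

definition mcut :: "'a pair_pre_digraph \<Rightarrow> nat" where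
  "mcut G = Max {card (cut_edges G X) | X. X \<subseteq> pverts G}"

text \<open>
  Library matrices are indexed by natural numbers, so the matrices of a graph are taken
  with respect to an enumeration \<open>vs\<close> of its vertices.
\<close>

definition is_enum :: "'a pair_pre_digraph \<Rightarrow> 'a list \<Rightarrow> bool" where
  "is_enum G vs \<longleftrightarrow> distinct vs \<and> set vs = pverts G"

definition adjacency_matrix :: "'a pair_pre_digraph \<Rightarrow> 'a list \<Rightarrow> real mat" where
  "adjacency_matrix G vs = mat (length vs) (length vs)
     (\<lambda>(i, j). if (vs ! i, vs ! j) \<in> parcs G then 1 else 0)"

definition degree_matrix :: "'a pair_pre_digraph \<Rightarrow> 'a list \<Rightarrow> real mat" where
  "degree_matrix G vs = mat_diag (length vs) (\<lambda>i. real (out_degree (with_proj G) (vs ! i)))"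

definition laplacian :: "'a pair_pre_digraph \<Rightarrow> 'a list \<Rightarrow> real mat" where
  "laplacian G vs = degree_matrix G vs - adjacency_matrix G vs"

lemma laplacian_index:
  assumes "i < length vs" "j < length vs"
  shows "laplacian G vs $$ (i, j) =
    (if i = j then real (out_degree (with_proj G) (vs ! i)) else 0) -
    (if (vs ! i, vs ! j) \<in> parcs G then 1 else 0)"
  using assms by (simp add: laplacian_def degree_matrix_def adjacency_matrix_def mat_diag_def)

lemma laplacian_carrier: "laplacian G vs \<in> carrier_mat (length vs) (length vs)"
  by (rule carrier_matI) (simp_all add: laplacian_def degree_matrix_def adjacency_matrix_def mat_diag_def)

lemma eigenvalue_laplacian_iff:
  assumes "is_enum G vs"
  shows "eigenvalue (laplacian G vs) k \<longleftrightarrow>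
    (\<exists>f. (\<exists>v\<in>pverts G. f v \<noteq> 0) \<and> (\<forall>v\<in>pverts G.
      (\<Sum>u\<in>pverts G. ((if v = u then real (out_degree (with_proj G) v) else 0) -
        (if (v, u) \<in> parcs G then 1 else 0)) * f u) = k * f v))"
    (is "_ \<longleftrightarrow> (\<exists>f. ?P f)")
proof -
  let ?n = "length vs"
  let ?l = "\<lambda>v u. (if v = u then real (out_degree (with_proj G) v) else 0) -
        (if (v, u) \<in> parcs G then 1 else 0)"
  from assms have d: "distinct vs" and s: "pverts G = set vs" by (auto simp: is_enum_def)
  have bij: "bij_betw ((!) vs) {0..<?n} (pverts G)"
    using d s by (auto intro!: bij_betw_nth)
  have mult: "(laplacian G vs *\<^sub>v x) $ i = (\<Sum>u\<in>pverts G. ?l (vs ! i) u * f u)"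
    if "i < ?n" "x \<in> carrier_vec ?n" "\<And>j. j < ?n \<Longrightarrow> x $ j = f (vs ! j)" for i x f
  proof -
    have "(laplacian G vs *\<^sub>v x) $ i = (\<Sum>j = 0..<?n. laplacian G vs $$ (i, j) * x $ j)"
      using that laplacian_carrier[of G vs] by (auto simp: scalar_prod_def)
    also have "\<dots> = (\<Sum>j = 0..<?n. ?l (vs ! i) (vs ! j) * f (vs ! j))"
      using that d by (intro sum.cong) (auto simp: laplacian_index nth_eq_iff_index_eq)
    also have "\<dots> = (\<Sum>u\<in>pverts G. ?l (vs ! i) u * f u)"
      by (rule sum.reindex_bij_betw[OF bij])
    finally show ?thesis .
  qed
  have dim: "dim_row (laplacian G vs) = ?n" using laplacian_carrier[of G vs] by auto
  show ?thesis
  proof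
    assume "eigenvalue (laplacian G vs) k"
    then obtain x where x: "x \<in> carrier_vec ?n" "x \<noteq> 0\<^sub>v ?n"
      "laplacian G vs *\<^sub>v x = k \<cdot>\<^sub>v x"
      by (auto simp: eigenvalue_def eigenvector_def dim)
    define f where "f v = x $ (the_inv_into {0..<?n} ((!) vs) v)" for v
    have f: "x $ j = f (vs ! j)" if "j < ?n" for j
      using that bij by (auto simp: f_def bij_betw_def the_inv_into_f_f)
    obtain i where "i < ?n" "x $ i \<noteq> 0" using x(1,2) by (auto simp: vec_eq_iff)
    then have "\<exists>v\<in>pverts G. f v \<noteq> 0" using f s by (metis nth_mem)
    moreover have "(\<Sum>u\<in>pverts G. ?l v u * f u) = k * f v" if v: "v \<in> pverts G" for v
    proof -
      obtain i where i: "i < ?n" "v = vs ! i" using v s by (auto simp: in_set_conv_nth)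
      show ?thesis
        using mult[OF i(1) x(1) f] x(1,3) i f[OF i(1)] by auto
    qed
    ultimately show "\<exists>f. ?P f" by blast
  next
    assume "\<exists>f. ?P f"
    then obtain f where f: "?P f" by blast
    define x where "x = vec ?n (\<lambda>j. f (vs ! j))"
    have x: "x \<in> carrier_vec ?n" "\<And>j. j < ?n \<Longrightarrow> x $ j = f (vs ! j)" by (auto simp: x_def)
    have "x \<noteq> 0\<^sub>v ?n" using f s x(2) by (metis in_set_conv_nth index_zero_vec(1))
    moreover have "laplacian G vs *\<^sub>v x = k \<cdot>\<^sub>v x"
    proof (rule eq_vecI)
      fix i assume "i < dim_vec (k \<cdot>\<^sub>v x)"
      then have i: "i < ?n" using x(1) by auto
      show "(laplacian G vs *\<^sub>v x) $ i = (k \<cdot>\<^sub>v x) $ i"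
        using mult[OF i x] f s i x by auto
    qed (use x dim in auto)
    ultimately show "eigenvalue (laplacian G vs) k"
      using x(1) by (auto simp: eigenvalue_def eigenvector_def dim)
  qed
qed

lemma eigenvalue_laplacian_cong:
  assumes "is_enum G vs" "is_enum G ws"
  shows "eigenvalue (laplacian G vs) k \<longleftrightarrow> eigenvalue (laplacian G ws) k"
  unfolding eigenvalue_laplacian_iff[OF assms(1)] eigenvalue_laplacian_iff[OF assms(2)] ..

text \<open>
  By the previous lemma the choice of the enumeration is immaterial. The maximum is
  meaningful only for a nonempty vertex set.
\<close>

definition mu1 :: "'a pair_pre_digraph \<Rightarrow> real" where
  "mu1 G = Max {k. eigenvalue (laplacian G (SOME vs. is_enum G vs)) k}"

definition L_exact :: "'a pair_pre_digraph \<Rightarrow> bool" where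
  "L_exact G \<longleftrightarrow> mu1 G = 4 / real (card (pverts G)) * real (mcut G)"

end

theory Submission
  imports Defs
begin

text \<open>
  Put $N = 2n$. Two bounds hold for every graph on $N$ vertices: no Laplacian eigenvalue
  exceeds $N$, and no cut has more than $N^2/4$ edges. The balanced join attains both of them,
  and the same bipartition is responsible each time: all $n^2$ pairs between the two
  sides are edges, so the cut along the sides has $n^2 = N^2/4$ edges, and the vector that is
  $1$ on one side and $-1$ on the other is an eigenvector for $2n = N$, because edges inside a
  side contribute nothing. Hence $\mu_1 = N = \frac{4}{N}\cdot\frac{N^2}{4}$.

  The eigenvalue bound (\<open>laplacian_eigenvalue_le_card\<close>) comes from the quadratic form
  $\frac12\sum_{u \sim v}(f(u)-f(v))^2$: extending the sum from the adjacent pairs to all pairs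
  can only increase it, and over all pairs it equals
  $N\sum_v f(v)^2 - \left(\sum_v f(v)\right)^2 \le N\sum_v f(v)^2$.
\<close>

section \<open>The Laplacian as a difference operator\<close>

text \<open>
  The degree of $v$ counts the neighbours of $v$, so one copy of $f(v)$ can be moved into
  each summand. In this form both the quadratic form and the effect of the operator on a
  function that is constant on the sides of a join can be read off.
\<close>

lemma laplacian_apply:
  fixes f :: "'a \<Rightarrow> real"
  assumes "pair_graph G" "v \<in> pverts G"
  shows "(\<Sum>u\<in>pverts G. ((if v = u then real (out_degree (with_proj G) v) else 0) -
        (if (v, u) \<in> parcs G then 1 else 0)) * f u)
      = (\<Sum>u\<in>pverts G. if (v, u) \<in> parcs G then f v - f u else 0)"
proof -
  interpret pair_graph G by fact
  have fin: "finite (pverts G)" by simp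
  have "out_arcs (with_proj G) v = Pair v ` {u \<in> pverts G. (v, u) \<in> parcs G}"
    using wellformed' by (auto simp: out_arcs_def)
  then have "out_degree (with_proj G) v = card {u \<in> pverts G. (v, u) \<in> parcs G}"
    by (simp add: out_degree_def card_image inj_on_def)
  then have deg: "real (out_degree (with_proj G) v)
      = (\<Sum>u\<in>pverts G. if (v, u) \<in> parcs G then 1 else 0)"
    using fin by (simp add: sum.If_cases Int_def)
  have "(\<Sum>u\<in>pverts G. ((if v = u then real (out_degree (with_proj G) v) else 0) -
        (if (v, u) \<in> parcs G then 1 else 0)) * f u)
      = (\<Sum>u\<in>pverts G. if v = u then real (out_degree (with_proj G) v) * f u else 0)
        - (\<Sum>u\<in>pverts G. if (v, u) \<in> parcs G then f u else 0)"
    unfolding sum_subtractf[symmetric] by (intro sum.cong) (auto simp: algebra_simps)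
  also have "(\<Sum>u\<in>pverts G. if v = u then real (out_degree (with_proj G) v) * f u else 0)
      = real (out_degree (with_proj G) v) * f v"
    using fin assms(2) by simp
  also have "\<dots> = (\<Sum>u\<in>pverts G. if (v, u) \<in> parcs G then f v else 0)"
    unfolding deg sum_distrib_right by (intro sum.cong) auto
  finally show ?thesis
    unfolding sum_subtractf[symmetric] by (simp add: if_distrib cong: if_cong sum.cong)
qed

text \<open>Pairing each arc with its reverse turns $f(v)(f(v)-f(u))$ into half a square.\<close>

lemma laplacian_quadratic_form:
  fixes f :: "'a \<Rightarrow> real"
  assumes "pair_graph G"
  shows "2 * (\<Sum>v\<in>pverts G. f v * (\<Sum>u\<in>pverts G. if (v, u) \<in> parcs G then f v - f u else 0))
      = (\<Sum>v\<in>pverts G. \<Sum>u\<in>pverts G. if (v, u) \<in> parcs G then (f v - f u)\<^sup>2 else 0)"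
proof -
  interpret pair_graph G by fact
  have sym: "(u, v) \<in> parcs G \<longleftrightarrow> (v, u) \<in> parcs G" for u v
    using arcs_symmetric by auto
  let ?g = "\<lambda>v u. if (v, u) \<in> parcs G then f v * (f v - f u) else 0"
  have S: "(\<Sum>v\<in>pverts G. f v * (\<Sum>u\<in>pverts G. if (v, u) \<in> parcs G then f v - f u else 0))
      = (\<Sum>v\<in>pverts G. \<Sum>u\<in>pverts G. ?g v u)"
    unfolding sum_distrib_left by (intro sum.cong) auto
  have swap: "(\<Sum>v\<in>pverts G. \<Sum>u\<in>pverts G. ?g v u) = (\<Sum>v\<in>pverts G. \<Sum>u\<in>pverts G. ?g u v)"
    by (rule sum.swap)
  have "2 * (\<Sum>v\<in>pverts G. \<Sum>u\<in>pverts G. ?g v u)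
      = (\<Sum>v\<in>pverts G. \<Sum>u\<in>pverts G. ?g v u) + (\<Sum>v\<in>pverts G. \<Sum>u\<in>pverts G. ?g u v)"
    using swap by linarith
  also have "\<dots> = (\<Sum>v\<in>pverts G. \<Sum>u\<in>pverts G.
      if (v, u) \<in> parcs G then (f v - f u)\<^sup>2 else 0)"
    unfolding sum.distrib[symmetric]
    by (intro sum.cong) (auto simp: sym algebra_simps power2_eq_square)
  finally show ?thesis unfolding S .
qed

lemma sum_pairwise_square_diffs:
  fixes f :: "'a \<Rightarrow> real"
  shows "(\<Sum>v\<in>A. \<Sum>u\<in>A. (f v - f u)\<^sup>2)
      = 2 * (real (card A) * (\<Sum>v\<in>A. (f v)\<^sup>2) - (\<Sum>v\<in>A. f v)\<^sup>2)"
proof -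
  have "(\<Sum>v\<in>A. \<Sum>u\<in>A. (f v - f u)\<^sup>2)
      = (\<Sum>v\<in>A. \<Sum>u\<in>A. (f v)\<^sup>2 + (f u)\<^sup>2 - 2 * (f v * f u))"
    by (simp add: power2_diff mult.assoc)
  also have "\<dots> = 2 * (real (card A) * (\<Sum>v\<in>A. (f v)\<^sup>2)) - 2 * (\<Sum>v\<in>A. \<Sum>u\<in>A. f v * f u)"
    by (simp add: sum.distrib sum_subtractf sum_distrib_left mult.commute)
  also have "(\<Sum>v\<in>A. \<Sum>u\<in>A. f v * f u) = (\<Sum>v\<in>A. f v)\<^sup>2"
    by (simp add: sum_product power2_eq_square)
  finally show ?thesis by simp
qed

section \<open>Bounds on Laplacian eigenvalues and on cuts\<close>

text \<open>
  This is the comparison of $G$ with the complete graph on its vertices: adding the missing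
  edges only adds squares to the quadratic form.
\<close>

lemma laplacian_eigenvalue_le_card:
  assumes G: "pair_graph G" and vs: "is_enum G vs" and k: "eigenvalue (laplacian G vs) k"
  shows "k \<le> real (card (pverts G))"
proof -
  interpret pair_graph G by fact
  let ?V = "pverts G"
  obtain f where nz: "\<exists>v\<in>?V. f v \<noteq> 0"
    and f: "\<And>v. v \<in> ?V \<Longrightarrow> (\<Sum>u\<in>?V. if (v, u) \<in> parcs G then f v - f u else 0) = k * f v"
    using k unfolding eigenvalue_laplacian_iff[OF vs] by (auto simp: laplacian_apply[OF G])
  have pos: "(\<Sum>v\<in>?V. (f v)\<^sup>2) > 0"
    using nz by (auto intro: sum_pos2)
  have "2 * (k * (\<Sum>v\<in>?V. (f v)\<^sup>2)) = 2 * (\<Sum>v\<in>?V. f v * (k * f v))"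
    by (simp add: sum_distrib_left power2_eq_square algebra_simps)
  also have "\<dots> = (\<Sum>v\<in>?V. \<Sum>u\<in>?V. if (v, u) \<in> parcs G then (f v - f u)\<^sup>2 else 0)"
    unfolding laplacian_quadratic_form[OF G, symmetric] by (simp add: f)
  also have "\<dots> \<le> (\<Sum>v\<in>?V. \<Sum>u\<in>?V. (f v - f u)\<^sup>2)"
    by (intro sum_mono) auto
  also have "\<dots> \<le> 2 * (real (card ?V) * (\<Sum>v\<in>?V. (f v)\<^sup>2))"
    by (simp add: sum_pairwise_square_diffs)
  finally show ?thesis using pos by simp
qed

text \<open>
  This makes the maximum in \<open>mu1\<close> meaningful: the eigenvalues are the roots of the
  characteristic polynomial.
\<close>

lemma finite_laplacian_eigenvalues: "finite {k. eigenvalue (laplacian G vs) k}"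
proof -
  have "monic (char_poly (laplacian G vs))"
    using degree_monic_char_poly[OF laplacian_carrier[of G vs]] by simp
  then have "char_poly (laplacian G vs) \<noteq> 0" by auto
  then show ?thesis
    using poly_roots_finite by (simp add: eigenvalue_root_char_poly[OF laplacian_carrier])
qed

text \<open>
  A cut edge is determined by its endpoints on the two sides, so a cut with sides of sizes $a$
  and $b$ has at most $ab \le (a+b)^2/4$ edges.
\<close>

lemma card_cut_edges_le:
  assumes "pair_graph G" "X \<subseteq> pverts G"
  shows "4 * card (cut_edges G X) \<le> (card (pverts G))\<^sup>2"
proof -
  interpret pair_graph G by fact
  let ?Y = "pverts G - X"
  have finX: "finite X" using finite_subset[OF assms(2)] by simp
  have "cut_edges G X \<subseteq> (\<lambda>(x, y). {x, y}) ` (X \<times> ?Y)"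
  proof
    fix e assume "e \<in> cut_edges G X"
    then obtain u v where e: "e = {u, v}" "(u, v) \<in> parcs G" and c: "card (e \<inter> X) = 1"
      by (auto simp: cut_edges_def edges_def)
    have uv: "u \<in> pverts G" "v \<in> pverts G" "u \<noteq> v"
      using wellformed'[OF e(2)] pair_no_loops[OF e(2)] by auto
    from c have "u \<in> X \<and> v \<notin> X \<or> v \<in> X \<and> u \<notin> X"
      using uv(3) unfolding e(1) by (cases "u \<in> X"; cases "v \<in> X") auto
    with uv have "(u, v) \<in> X \<times> ?Y \<or> (v, u) \<in> X \<times> ?Y" by auto
    then show "e \<in> (\<lambda>(x, y). {x, y}) ` (X \<times> ?Y)"
      unfolding e(1) by (force simp: insert_commute)
  qed
  then have "card (cut_edges G X) \<le> card X * card ?Y"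
    using finX surj_card_le[of "X \<times> ?Y"] by (simp add: card_cartesian_product)
  moreover have "card (pverts G) = card X + card ?Y"
    using finX assms(2) by (simp add: card_Diff_subset card_mono)
  moreover have "4 * (card X * card ?Y) \<le> (card X + card ?Y)\<^sup>2"
  proof -
    have "4 * (real (card X) * real (card ?Y)) \<le> (real (card X) + real (card ?Y))\<^sup>2"
      using sum_squares_bound[of "real (card X)" "real (card ?Y)"] by (simp add: power2_sum)
    then have "real (4 * (card X * card ?Y)) \<le> real ((card X + card ?Y)\<^sup>2)" by simp
    then show ?thesis by (simp only: of_nat_le_iff)
  qed
  ultimately show ?thesis by simp
qed

section \<open>Both bounds are attained by a balanced join\<close>

lemma mcut_join:
  assumes "pair_graph H1" "pair_graph H2" and disj: "pverts H1 \<inter> pverts H2 = {}"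
    and n: "card (pverts H1) = n" "card (pverts H2) = n"
  shows "mcut (H1 \<nabla> H2) = n\<^sup>2"
proof -
  let ?G = "H1 \<nabla> H2" and ?V1 = "pverts H1" and ?V2 = "pverts H2"
  interpret H1: pair_graph H1 by fact
  interpret H2: pair_graph H2 by fact
  interpret G: pair_graph ?G by (rule pair_graph_join) fact+
  have V: "pverts ?G = ?V1 \<union> ?V2" by (simp add: graph_join_def)
  have cardV: "card (pverts ?G) = 2 * n"
    using disj n by (simp add: V card_Un_disjoint)
  have upper: "card (cut_edges ?G X) \<le> n\<^sup>2" if "X \<subseteq> pverts ?G" for X
    using card_cut_edges_le[OF G.pair_graph_axioms that] by (simp add: cardV power_mult_distrib)
  have fin: "finite (cut_edges ?G ?V1)"
  proof -
    have "cut_edges ?G ?V1 \<subseteq> Pow (pverts ?G)"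
      using G.wellformed' by (auto simp: cut_edges_def edges_def)
    then show ?thesis using G.pair_finite_verts by (meson finite_Pow_iff finite_subset)
  qed
  have sub: "(\<lambda>(x, y). {x, y}) ` (?V1 \<times> ?V2) \<subseteq> cut_edges ?G ?V1"
  proof clarify
    fix x y assume xy: "x \<in> ?V1" "y \<in> ?V2"
    then have "{x, y} \<inter> ?V1 = {x}" using disj by auto
    then have "card ({x, y} \<inter> ?V1) = 1" by simp
    moreover have "{x, y} \<in> edges ?G"
      using xy by (auto simp: edges_def graph_join_def)
    ultimately show "{x, y} \<in> cut_edges ?G ?V1" by (simp add: cut_edges_def)
  qed
  have "inj_on (\<lambda>(x, y). {x, y}) (?V1 \<times> ?V2)"
    using disj by (auto simp: inj_on_def doubleton_eq_iff)
  then have "n\<^sup>2 = card ((\<lambda>(x, y). {x, y}) ` (?V1 \<times> ?V2))"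
    by (simp add: card_image card_cartesian_product n power2_eq_square)
  also have "\<dots> \<le> card (cut_edges ?G ?V1)"
    using sub fin by (rule card_mono[rotated])
  finally have eq: "card (cut_edges ?G ?V1) = n\<^sup>2"
    using upper[of ?V1] by (simp add: V)
  show ?thesis
    unfolding mcut_def
  proof (rule Max_eqI)
    have "{card (cut_edges ?G X) | X. X \<subseteq> pverts ?G} = (\<lambda>X. card (cut_edges ?G X)) ` Pow (pverts ?G)"
      by auto
    then show "finite {card (cut_edges ?G X) | X. X \<subseteq> pverts ?G}" by simp
    show "n\<^sup>2 \<in> {card (cut_edges ?G X) | X. X \<subseteq> pverts ?G}"
      using eq V by (auto intro!: exI[of _ ?V1])
  qed (use upper in auto)
qed

lemma mu1_join:
  assumes "pair_graph H1" "pair_graph H2" and disj: "pverts H1 \<inter> pverts H2 = {}"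
    and n: "card (pverts H1) = n" "card (pverts H2) = n" and "n \<ge> 1"
  shows "mu1 (H1 \<nabla> H2) = 2 * real n"
proof -
  let ?G = "H1 \<nabla> H2" and ?V1 = "pverts H1" and ?V2 = "pverts H2"
  interpret H1: pair_graph H1 by fact
  interpret H2: pair_graph H2 by fact
  interpret G: pair_graph ?G by (rule pair_graph_join) fact+
  have V: "pverts ?G = ?V1 \<union> ?V2" by (simp add: graph_join_def)
  have cardV: "card (pverts ?G) = 2 * n"
    using disj n by (simp add: V card_Un_disjoint)
  define vs where "vs = (SOME vs. is_enum ?G vs)"
  have "\<exists>vs. is_enum ?G vs"
    using finite_distinct_list[OF G.pair_finite_verts] by (auto simp: is_enum_def)
  then have vs: "is_enum ?G vs" unfolding vs_def by (rule someI_ex)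
  define f :: "'a \<Rightarrow> real" where "f v = (if v \<in> ?V1 then 1 else -1)" for v
  have "\<exists>v\<in>pverts ?G. f v \<noteq> 0"
  proof -
    have "?V1 \<noteq> {}" using n(1) \<open>n \<ge> 1\<close> by auto
    then show ?thesis by (auto simp: V f_def)
  qed
  moreover have "(\<Sum>u\<in>pverts ?G. if (v, u) \<in> parcs ?G then f v - f u else 0) = 2 * real n * f v"
    if v: "v \<in> pverts ?G" for v
  proof -
    have split: "(\<Sum>u\<in>pverts ?G. if (v, u) \<in> parcs ?G then f v - f u else 0)
        = (\<Sum>u\<in>?V1. if (v, u) \<in> parcs ?G then f v - f u else 0)
          + (\<Sum>u\<in>?V2. if (v, u) \<in> parcs ?G then f v - f u else 0)"
      unfolding V using disj by (intro sum.union_disjoint) auto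
    have V2: "u \<notin> ?V1" if "u \<in> ?V2" for u using disj that by auto
    show ?thesis
    proof (cases "v \<in> ?V1")
      case True
      have "(\<Sum>u\<in>?V1. if (v, u) \<in> parcs ?G then f v - f u else 0) = 0"
        using True by (intro sum.neutral) (auto simp: f_def)
      moreover have "(\<Sum>u\<in>?V2. if (v, u) \<in> parcs ?G then f v - f u else 0) = (\<Sum>u\<in>?V2. 2)"
        using True V2 by (intro sum.cong) (auto simp: f_def graph_join_def)
      ultimately show ?thesis using True n unfolding split by (simp add: f_def)
    next
      case False
      then have v2: "v \<in> ?V2" using v V by auto
      have "(\<Sum>u\<in>?V2. if (v, u) \<in> parcs ?G then f v - f u else 0) = 0"
        using False V2 by (intro sum.neutral) (auto simp: f_def)
      moreover have "(\<Sum>u\<in>?V1. if (v, u) \<in> parcs ?G then f v - f u else 0) = (\<Sum>u\<in>?V1. -2)"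
        using False v2 by (intro sum.cong) (auto simp: f_def graph_join_def)
      ultimately show ?thesis using False n unfolding split by (simp add: f_def)
    qed
  qed
  ultimately have ev: "eigenvalue (laplacian ?G vs) (2 * real n)"
    unfolding eigenvalue_laplacian_iff[OF vs]
    by (intro exI[of _ f]) (simp add: laplacian_apply[OF G.pair_graph_axioms])
  show ?thesis
    unfolding mu1_def vs_def[symmetric]
  proof (rule Max_eqI)
    fix k assume "k \<in> {k. eigenvalue (laplacian ?G vs) k}"
    then show "k \<le> 2 * real n"
      using laplacian_eigenvalue_le_card[OF G.pair_graph_axioms vs] cardV by auto
  qed (use ev finite_laplacian_eigenvalues in auto)
qed

theorem proposition4p2:
  fixes H1 H2 :: "'a pair_pre_digraph" and n :: nat
  assumes "pair_graph H1" and "pair_graph H2"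
    and "pverts H1 \<inter> pverts H2 = {}"
    and "card (pverts H1) = n" and "card (pverts H2) = n"
    and "n \<ge> 1"
  shows "L_exact (H1 \<nabla> H2)"
proof -
  interpret H1: pair_graph H1 by fact
  interpret H2: pair_graph H2 by fact
  have "card (pverts (H1 \<nabla> H2)) = 2 * n"
    using assms(3-5) by (simp add: graph_join_def card_Un_disjoint)
  then show ?thesis
    using mu1_join[OF assms] mcut_join[OF assms(1-5)] \<open>n \<ge> 1\<close>
    by (simp add: L_exact_def power2_eq_square)
qed

end
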